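(* Let $\mathfrak{A}$ be a JBW$^*$-algebra. Then the set $\mathcal{U}(\mathfrak{A})$ of unitary elements of $\mathfrak{A}$ is closed under Jordan products of operator commuting pairs: if $u,v\in\mathcal{U}(\mathfrak{A})$ operator commute in $\mathfrak{A}$, then $u\circ v\in\mathcal{U}(\mathfrak{A})$.
   Context: A JB$^*$-algebra is a complex Jordan Banach algebra $(\mathfrak{A},\circ)$ with an involution $*$ such that $\|U_a(a^* )\|=\|a\|^3$ for all $a$, where $U_a(b)=2(a\circ b)\circ a-a^2\circ b$. A JBW$^*$-algebra is a JB$^*$-algebra that is a dual Banach space (automatically unital, with unit $\mathbf{1}$). Elements $a,b\in\mathfrak{A}$ operator commute if $(a\circ c)\circ b=a\circ(c\circ b)$ for all $c\in\mathfrak{A}$. An element $a$ is invertible with inverse $b$ if $a\circ b=\mathbf{1}$ and $a^2\circ b=a$; $u$ is unitary if it is invertible with inverse $u^*$. *)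

theory Defs
  imports "HOL-Analysis.Analysis"
begin

text \<open>
  The distribution has no type class of complex normed spaces, so a complex Banach space is a
  real Banach space (class \<open>banach\<close>) with a complex scalar multiplication extending the real one.
\<close>

locale complex_banach_space = vector_space scaleC
  for scaleC :: "complex \<Rightarrow> 'a::banach \<Rightarrow> 'a" +
  assumes scaleC_of_real: "scaleC (of_real r) x = r *\<^sub>R x"
    and norm_scaleC: "norm (scaleC c x) = cmod c * norm x"

text \<open>
  The complex-linear functionals among the bounded real-linear ones; the norm of
  \<^typ>\<open>'p::banach \<Rightarrow>\<^sub>L complex\<close> restricts to the usual dual norm.
\<close>

definition complex_dual :: "(complex \<Rightarrow> 'p::banach \<Rightarrow> 'p) \<Rightarrow> ('p \<Rightarrow>\<^sub>L complex) set" where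
  "complex_dual scaleP = {\<phi>. \<forall>c x. blinfun_apply \<phi> (scaleP c x) = c * blinfun_apply \<phi> x}"

locale complex_jordan_banach_algebra = complex_banach_space scaleC
  for scaleC :: "complex \<Rightarrow> 'a::banach \<Rightarrow> 'a" +
  fixes jprod :: "'a \<Rightarrow> 'a \<Rightarrow> 'a"
  assumes jprod_commute: "jprod a b = jprod b a"
    and jprod_add_left: "jprod (a + b) c = jprod a c + jprod b c"
    and jprod_scaleC_left: "jprod (scaleC z a) b = scaleC z (jprod a b)"
    and jordan_identity: "jprod (jprod a b) (jprod a a) = jprod a (jprod b (jprod a a))"
    and norm_jprod_le: "norm (jprod a b) \<le> norm a * norm b"

definition U_op :: "('a::real_vector \<Rightarrow> 'a \<Rightarrow> 'a) \<Rightarrow> 'a \<Rightarrow> 'a \<Rightarrow> 'a" where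
  "U_op jprod a b = 2 *\<^sub>R jprod (jprod a b) a - jprod (jprod a a) b"

locale jb_star_algebra = complex_jordan_banach_algebra scaleC jprod
  for scaleC :: "complex \<Rightarrow> 'a::banach \<Rightarrow> 'a" and jprod :: "'a \<Rightarrow> 'a \<Rightarrow> 'a" +
  fixes star :: "'a \<Rightarrow> 'a"
  assumes star_star: "star (star a) = a"
    and star_add: "star (a + b) = star a + star b"
    and star_scaleC: "star (scaleC z a) = scaleC (cnj z) (star a)"
    and star_jprod: "star (jprod a b) = jprod (star b) (star a)"
    and norm_U_star: "norm (U_op jprod a (star a)) = norm a ^ 3"

text \<open>
  A JBW*-algebra is isometrically isomorphic, as a complex Banach space, to the dual of some
  complex Banach space. HOL cannot quantify existentially over types, so the predual (type
  \<open>'p\<close> with scalar multiplication \<open>scaleP\<close>) is a parameter; in a theorem assuming this locale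
  it is universally quantified, which amounts to the existential hypothesis.
\<close>

locale jbw_star_algebra =
  jb_star_algebra scaleC jprod star + predual: complex_banach_space scaleP
  for scaleC :: "complex \<Rightarrow> 'a::banach \<Rightarrow> 'a" and jprod :: "'a \<Rightarrow> 'a \<Rightarrow> 'a"
    and star :: "'a \<Rightarrow> 'a" and scaleP :: "complex \<Rightarrow> 'p::banach \<Rightarrow> 'p" +
  assumes dual_banach_space:
    "\<exists>\<Phi> :: 'a \<Rightarrow> ('p \<Rightarrow>\<^sub>L complex).
       bij_betw \<Phi> UNIV (complex_dual scaleP) \<and>
       (\<forall>a b. \<Phi> (a + b) = \<Phi> a + \<Phi> b) \<and>
       (\<forall>z a x. blinfun_apply (\<Phi> (scaleC z a)) x = z * blinfun_apply (\<Phi> a) x) \<and>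
       (\<forall>a. norm (\<Phi> a) = norm a)"

definition operator_commute :: "('a \<Rightarrow> 'a \<Rightarrow> 'a) \<Rightarrow> 'a \<Rightarrow> 'a \<Rightarrow> bool" where
  "operator_commute jprod a b \<longleftrightarrow> (\<forall>c. jprod (jprod a c) b = jprod a (jprod c b))"

definition is_unit_element :: "('a \<Rightarrow> 'a \<Rightarrow> 'a) \<Rightarrow> 'a \<Rightarrow> bool" where
  "is_unit_element jprod e \<longleftrightarrow> (\<forall>a. jprod e a = a \<and> jprod a e = a)"

lemma is_unit_element_unique:
  "is_unit_element jprod e \<Longrightarrow> is_unit_element jprod f \<Longrightarrow> e = f"
  unfolding is_unit_element_def by metis

text \<open>
  JBW*-algebras are automatically unital, so the unit is not part of the structure. As a unit is
  unique, the witness \<open>e\<close> below is the unit of the algebra.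
\<close>

definition jordan_inverse :: "('a \<Rightarrow> 'a \<Rightarrow> 'a) \<Rightarrow> 'a \<Rightarrow> 'a \<Rightarrow> bool" where
  "jordan_inverse jprod a b \<longleftrightarrow>
     (\<exists>e. is_unit_element jprod e \<and> jprod a b = e \<and> jprod (jprod a a) b = a)"

definition unitaries :: "('a \<Rightarrow> 'a \<Rightarrow> 'a) \<Rightarrow> ('a \<Rightarrow> 'a) \<Rightarrow> 'a set" where
  "unitaries jprod star = {u. jordan_inverse jprod u (star u)}"

end

theory Submission imports Defs begin

text \<open>
  Write \<open>L\<^sub>a\<close> for multiplication by \<open>a\<close>, \<open>U\<^sub>a = 2 L\<^sub>a L\<^sub>a - L\<^sub>b\<close> with \<open>b = a \<otimes> a\<close> for the quadratic
  operator, and \<open>u\<^sup>*\<close> for \<open>star u\<close>. Hypothesis: \<open>[L\<^sub>u, L\<^sub>v] = 0\<close>. In a general Jordan algebra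
  this does not pass to the square or the inverse of \<open>u\<close> (in an associative algebra, with the symmetrized
  product, it only means that \<open>u v - v u\<close> is central, as in the Weyl algebra). Some analysis must enter, and it enters once,
  as a rigidity principle for unitary \<open>u\<close>:

    if the commutator \<open>G = [U\<^sub>u, L\<^sub>b]\<close> commutes with \<open>U\<^sub>u\<close>, then \<open>G = 0\<close> (\<open>quad_commutator_rigid\<close>).

  Indeed, with \<open>V = U\<^sub>u\<close> and \<open>H = G V\<^sup>-\<^sup>1\<close>, conjugation gives \<open>V\<^sup>n L\<^sub>b V\<^sup>-\<^sup>n = L\<^sub>b + n H\<close>. Squares
  of unitaries are unitary and \<open>U\<close> of a square is the square of \<open>U\<close>, so for \<open>n = 2\<^sup>k\<close> the operator
  \<open>V\<^sup>n\<close> is the quadratic operator of a unitary; a unitary has norm at most \<open>1\<close> by the norm axiom, whence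
  \<open>V\<^sup>n\<close> and its inverse have norm at most \<open>3\<close>. Thus \<open>n H\<close> stays bounded and \<open>H = 0\<close>.

  The hypothesis on commutators is checked algebraically: \<open>[L\<^sub>a, L\<^sub>b]\<close> is a derivation, so it
  commutes with \<open>L\<^sub>u\<close> and \<open>U\<^sub>u\<close> as soon as it kills \<open>u\<close>. The principle is applied twice.

  (1) \<open>[U\<^sub>u, L\<^sub>v]\<close> equals \<open>[L\<^sub>v, L\<^sub>b]\<close>, \<open>b = u \<otimes> u\<close>, which kills \<open>u\<close>. So \<open>L\<^sub>v\<close> commutes
  with \<open>L\<^sub>b\<close> and \<open>U\<^sub>u\<close>, hence with multiplication by \<open>u\<^sup>*\<close>, which is \<open>U\<^sub>u\<^sup>-\<^sup>1 L\<^sub>u\<close>. By symmetry each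
  of \<open>u, u\<^sup>*\<close> operator commutes with each of \<open>v, v\<^sup>*\<close>.

  (2) With \<open>b = u\<^sup>* \<otimes> v\<close>, the derivation \<open>E = [L\<^sub>u, L\<^sub>b]\<close> kills \<open>u\<close> and \<open>[U\<^sub>u, L\<^sub>b] = 4 L\<^sub>u E\<close>, so
  \<open>L\<^sub>u E = E L\<^sub>u = 0\<close>. The elements to which \<open>E\<close> and its analogues have to be applied are multiples
  of the unitary that takes the role of \<open>u\<close>, and evaluating there yields both equations that make \<open>u \<otimes> v\<close> unitary (\<open>unitary_jprod\<close>).
\<close>

section \<open>Inner derivations and the quadratic operators\<close>

context complex_jordan_banach_algebra
begin

notation jprod (infixl "\<otimes>" 70)

lemma jprod_add_right: "a \<otimes> (b + c) = a \<otimes> b + a \<otimes> c"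
  by (metis jprod_add_left jprod_commute)

lemma jprod_scaleR_left: "(r *\<^sub>R a) \<otimes> b = r *\<^sub>R (a \<otimes> b)"
  by (metis jprod_scaleC_left scaleC_of_real)

lemma jprod_scaleR_right: "a \<otimes> (r *\<^sub>R b) = r *\<^sub>R (a \<otimes> b)"
  by (metis jprod_scaleR_left jprod_commute)

lemma jprod_minus_left: "(- a) \<otimes> b = - (a \<otimes> b)"
  using jprod_scaleR_left[of "-1" a b] by simp

lemma jprod_minus_right: "a \<otimes> (- b) = - (a \<otimes> b)"
  using jprod_scaleR_right[of a "-1" b] by simp

lemma jprod_diff_left: "(a - b) \<otimes> c = a \<otimes> c - b \<otimes> c"
  using jprod_add_left[of a "- b" c] by (simp add: jprod_minus_left)

lemma jprod_diff_right: "a \<otimes> (b - c) = a \<otimes> b - a \<otimes> c"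
  using jprod_add_right[of a b "- c"] by (simp add: jprod_minus_right)

lemma jprod_zero_left: "0 \<otimes> a = 0"
  using jprod_scaleR_left[of 0 a a] by simp

lemma jprod_zero_right: "a \<otimes> 0 = 0"
  using jprod_scaleR_right[of a 0 a] by simp

lemmas jprod_linear = jprod_add_left jprod_add_right jprod_scaleR_left jprod_scaleR_right
  jprod_minus_left jprod_minus_right jprod_diff_left jprod_diff_right
  jprod_zero_left jprod_zero_right

text \<open>
  The commutator of two multiplication operators, applied to a vector. Operators are handled
  pointwise throughout.
\<close>

definition comm :: "'a \<Rightarrow> 'a \<Rightarrow> 'a \<Rightarrow> 'a" where
  "comm a b x = a \<otimes> (b \<otimes> x) - b \<otimes> (a \<otimes> x)"

lemma comm_swap: "comm a b x = - comm b a x"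
  by (simp add: comm_def)

lemma comm_linear_arg:
  "comm a b (x + y) = comm a b x + comm a b y"
  "comm a b (x - y) = comm a b x - comm a b y"
  "comm a b (r *\<^sub>R x) = r *\<^sub>R comm a b x"
  by (simp_all add: comm_def jprod_linear algebra_simps)

lemma double_eq_zero: "x + x = 0 \<Longrightarrow> x = 0" for x :: 'a
  by (metis scaleR_2 scaleR_eq_0_iff zero_neq_numeral)

lemma comm_square: "comm a (a \<otimes> a) x = 0"
proof -
  have "comm a (a \<otimes> a) x = a \<otimes> (x \<otimes> (a \<otimes> a)) - (a \<otimes> x) \<otimes> (a \<otimes> a)"
    by (simp add: comm_def jprod_commute)
  then show ?thesis
    using jordan_identity[of a x] by simp
qed

text \<open>
  Polarizing the Jordan identity: in the difference of its instances at \<open>a + c\<close> and \<open>a - c\<close> the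
  parts of odd degree in \<open>c\<close> survive, and the cubic one is again an instance.
\<close>

lemma comm_square_polarized: "comm c (a \<otimes> a) x + 2 *\<^sub>R comm a (a \<otimes> c) x = 0"
proof (rule double_eq_zero)
  have "comm (a + c) ((a + c) \<otimes> (a + c)) x - comm (a - c) ((a - c) \<otimes> (a - c)) x
      - 2 *\<^sub>R comm c (c \<otimes> c) x = 0"
    by (simp only: comm_square) simp
  then show "comm c (a \<otimes> a) x + 2 *\<^sub>R comm a (a \<otimes> c) x
     + (comm c (a \<otimes> a) x + 2 *\<^sub>R comm a (a \<otimes> c) x) = 0"
    by (simp add: comm_def jprod_linear algebra_simps scaleR_2 jprod_commute[of c a])
qed

lemma comm_cyclic: "comm a (b \<otimes> c) x + comm b (c \<otimes> a) x + comm c (a \<otimes> b) x = 0"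
proof (rule double_eq_zero)
  have "(comm c ((a + b) \<otimes> (a + b)) x + 2 *\<^sub>R comm (a + b) ((a + b) \<otimes> c) x)
      - (comm c (a \<otimes> a) x + 2 *\<^sub>R comm a (a \<otimes> c) x)
      - (comm c (b \<otimes> b) x + 2 *\<^sub>R comm b (b \<otimes> c) x) = 0"
    by (simp only: comm_square_polarized) simp
  then show "comm a (b \<otimes> c) x + comm b (c \<otimes> a) x + comm c (a \<otimes> b) x
     + (comm a (b \<otimes> c) x + comm b (c \<otimes> a) x + comm c (a \<otimes> b) x) = 0"
    by (simp add: comm_def jprod_linear algebra_simps scaleR_2
          jprod_commute[of b a] jprod_commute[of c a])
qed

text \<open>
  The cyclic identity read as a statement about operators acting on one of its original arguments;
  this is what expresses multiplication by a product through simpler multiplications.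
\<close>

lemma jordan_identity_linearized:
  "c \<otimes> (d \<otimes> (a \<otimes> x)) + a \<otimes> (d \<otimes> (c \<otimes> x)) + ((a \<otimes> c) \<otimes> d) \<otimes> x
   = (c \<otimes> d) \<otimes> (a \<otimes> x) + (a \<otimes> d) \<otimes> (c \<otimes> x) + (a \<otimes> c) \<otimes> (d \<otimes> x)"
  using comm_cyclic[of a x c d]
  by (simp add: comm_def algebra_simps jprod_commute)

text \<open>
  The right-hand side of the linearized identity is symmetric in its four entries and the left-hand
  side is not visibly so; the difference of two instances is the Leibniz rule.
\<close>

lemma comm_derivation: "comm a b (x \<otimes> y) = comm a b x \<otimes> y + x \<otimes> comm a b y"
  using jordan_identity_linearized[of a b x y] jordan_identity_linearized[of b a x y]
  by (simp add: comm_def jprod_linear algebra_simps jprod_commute)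

text \<open>
  The operator \<^const>\<open>U_op\<close> of a commutative product, arranged as a polynomial in the
  multiplications by \<open>a\<close> and by its square.
\<close>

definition quad :: "'a \<Rightarrow> 'a \<Rightarrow> 'a" where
  "quad a x = 2 *\<^sub>R (a \<otimes> (a \<otimes> x)) - (a \<otimes> a) \<otimes> x"

lemma quad_linear:
  "quad a (x + y) = quad a x + quad a y"
  "quad a (x - y) = quad a x - quad a y"
  "quad a (r *\<^sub>R x) = r *\<^sub>R quad a x"
  by (simp_all add: quad_def jprod_linear algebra_simps)

lemma square_commutes: "(a \<otimes> a) \<otimes> (a \<otimes> x) = a \<otimes> ((a \<otimes> a) \<otimes> x)"
  using comm_square[of a x] by (simp add: comm_def)

lemma scaleR_3: "3 *\<^sub>R y = y + y + y" for y :: 'a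
  using scaleR_add_left[of 2 1 y] by (simp add: scaleR_2)

lemma scaleR_4: "4 *\<^sub>R y = y + y + y + y" for y :: 'a
  using scaleR_add_left[of 3 1 y] by (simp add: scaleR_3)

lemma cube_operator:
  "((a \<otimes> a) \<otimes> a) \<otimes> x = 3 *\<^sub>R (a \<otimes> ((a \<otimes> a) \<otimes> x)) - 2 *\<^sub>R (a \<otimes> (a \<otimes> (a \<otimes> x)))"
  using jordan_identity_linearized[of a a a x]
  by (simp add: algebra_simps scaleR_2 scaleR_3 square_commutes)

lemma quad_jprod_self: "quad a (a \<otimes> x) = a \<otimes> quad a x"
  by (simp add: quad_def jprod_linear square_commutes)

text \<open>
  The one instance of the fundamental formula that the norm estimate uses. Multiplication by the
  fourth power of \<open>a\<close> is a polynomial in the commuting multiplications by \<open>a\<close> and \<open>a \<otimes> a\<close>, so it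
  reduces to expanding a square.
\<close>

lemma quad_square: "quad (a \<otimes> a) x = quad a (quad a x)"
proof -
  let ?b = "a \<otimes> a"
  have c1: "?b \<otimes> (a \<otimes> y) = a \<otimes> (?b \<otimes> y)" for y by (rule square_commutes)
  have "(?b \<otimes> ?b) \<otimes> x = (a \<otimes> (?b \<otimes> a)) \<otimes> x"
    using c1[of a] by simp
  also have "\<dots> = ((a \<otimes> ?b) \<otimes> a) \<otimes> x"
    by (simp add: jprod_commute)
  also have "\<dots> = 2 *\<^sub>R ((?b \<otimes> a) \<otimes> (a \<otimes> x)) + ?b \<otimes> (?b \<otimes> x) - 2 *\<^sub>R (a \<otimes> (a \<otimes> (?b \<otimes> x)))"
    using jordan_identity_linearized[of ?b a a x]
    by (simp add: algebra_simps scaleR_2 c1 jprod_commute[of a ?b])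
  also have "\<dots> = ?b \<otimes> (?b \<otimes> x) + 4 *\<^sub>R (a \<otimes> (a \<otimes> (?b \<otimes> x))) - 4 *\<^sub>R (a \<otimes> (a \<otimes> (a \<otimes> (a \<otimes> x))))"
    by (simp add: cube_operator c1 scaleR_diff_right)
       (simp add: algebra_simps flip: scaleR_add_left)
  finally have "(?b \<otimes> ?b) \<otimes> x
     = ?b \<otimes> (?b \<otimes> x) + 4 *\<^sub>R (a \<otimes> (a \<otimes> (?b \<otimes> x))) - 4 *\<^sub>R (a \<otimes> (a \<otimes> (a \<otimes> (a \<otimes> x))))" .
  then show ?thesis
    by (simp add: quad_def jprod_linear c1 scaleR_diff_right scaleR_2 scaleR_4)
qed

text \<open>
  A derivation that kills \<open>u\<close> kills its square, hence commutes with every operator built from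
  multiplications by these two.
\<close>

lemma comm_quad_of_fixed:
  assumes "comm a b u = 0"
  shows "comm a b (u \<otimes> x) = u \<otimes> comm a b x"
    and "comm a b (quad u x) = quad u (comm a b x)"
proof -
  show *: "comm a b (u \<otimes> x) = u \<otimes> comm a b x" for x
    using assms by (simp add: comm_derivation jprod_linear)
  have "comm a b (u \<otimes> u) = 0"
    using assms by (simp add: comm_derivation jprod_linear)
  then have "comm a b ((u \<otimes> u) \<otimes> x) = (u \<otimes> u) \<otimes> comm a b x"
    by (simp add: comm_derivation jprod_linear)
  then show "comm a b (quad u x) = quad u (comm a b x)"
    by (simp add: quad_def comm_linear_arg *)
qed

section \<open>Invertible elements\<close>

text \<open>
  For a unitary, applying the involution to one inverse relation gives the other, so both can be
  required here; this makes the notion symmetric, so that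
  each identity below yields a second one with \<open>u\<close> and \<open>i\<close> exchanged.
\<close>

definition mutual_inverses :: "'a \<Rightarrow> 'a \<Rightarrow> 'a \<Rightarrow> bool" where
  "mutual_inverses e u i \<longleftrightarrow> is_unit_element jprod e \<and> u \<otimes> i = e
     \<and> (u \<otimes> u) \<otimes> i = u \<and> (i \<otimes> i) \<otimes> u = i"

lemma mutual_inverses_sym: "mutual_inverses e u i \<Longrightarrow> mutual_inverses e i u"
  by (simp add: mutual_inverses_def jprod_commute)

context
  fixes e u i :: 'a
  assumes inv: "mutual_inverses e u i"
begin

lemma unit_left: "e \<otimes> x = x" and unit_right: "x \<otimes> e = x"
  using inv by (auto simp: mutual_inverses_def is_unit_element_def)

lemma inv_simps:
  "u \<otimes> i = e" "i \<otimes> u = e"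
  "(u \<otimes> u) \<otimes> i = u" "i \<otimes> (u \<otimes> u) = u"
  "(i \<otimes> i) \<otimes> u = i" "u \<otimes> (i \<otimes> i) = i"
  using inv by (simp_all add: mutual_inverses_def jprod_commute)

lemma inverse_square_commute: "i \<otimes> ((u \<otimes> u) \<otimes> x) = (u \<otimes> u) \<otimes> (i \<otimes> x)"
  using comm_square_polarized[of i u x]
  by (simp add: inv_simps comm_def unit_left)

lemma square_inverse_square: "(u \<otimes> u) \<otimes> (i \<otimes> i) = e"
  using inverse_square_commute[of i] by (simp add: inv_simps)

lemma comm_inverse_fixed: "comm u i u = 0" "comm u i i = 0"
  by (simp_all add: comm_def inv_simps unit_right)

text \<open>
  First step towards the commutation of an element with its inverse \<open>i\<close>. Multiplication by the cube of
  \<open>u\<close> is a polynomial in those by \<open>u\<close> and \<open>u \<otimes> u\<close>; commuting it past \<open>i\<close> leaves a multiple of the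
  quadratic operator applied to \<open>comm u i\<close>.
\<close>

lemma quad_comm_inverse: "quad u (comm u i x) = 0"
proof -
  let ?d = "comm u i"
  have du: "?d (u \<otimes> y) = u \<otimes> ?d y" for y
    by (rule comm_quad_of_fixed(1)) (rule comm_inverse_fixed)
  have "?d (u \<otimes> u) = 0"
    by (simp add: comm_derivation comm_inverse_fixed jprod_linear)
  then have du2: "?d ((u \<otimes> u) \<otimes> y) = (u \<otimes> u) \<otimes> ?d y" for y
    by (rule comm_quad_of_fixed(1))
  have ui: "u \<otimes> (i \<otimes> y) = i \<otimes> (u \<otimes> y) + ?d y" for y
    by (simp add: comm_def)
  \<comment> \<open>\<open>i\<close> operator commutes with the cube of \<open>u\<close> as well as with its square.\<close>
  have "comm i ((u \<otimes> u) \<otimes> u) x = 0"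
    using comm_cyclic[of i "u \<otimes> u" u x]
    by (simp add: inv_simps comm_def unit_left square_commutes)
  moreover have "comm i ((u \<otimes> u) \<otimes> u) x = 3 *\<^sub>R quad u (?d x)"
    by (simp add: comm_def[of i] cube_operator quad_def jprod_linear
          inverse_square_commute[symmetric] ui du du2)
       (simp add: algebra_simps scaleR_2 scaleR_3)
  ultimately have "3 *\<^sub>R quad u (?d x) = 0"
    by simp
  then show ?thesis by simp
qed

lemma inverse_sandwich: "2 *\<^sub>R (u \<otimes> (i \<otimes> (u \<otimes> x))) = u \<otimes> x + (u \<otimes> u) \<otimes> (i \<otimes> x)"
  using jordan_identity_linearized[of u i u x]
  by (simp add: inv_simps unit_left scaleR_2 algebra_simps)

end

lemma quad_inverse_square:
  assumes "mutual_inverses e u i"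
  shows "quad u ((i \<otimes> i) \<otimes> x) = 2 *\<^sub>R (i \<otimes> (u \<otimes> x)) - x"
  using jordan_identity_linearized[of u "i \<otimes> i" u x]
    inverse_square_commute[OF mutual_inverses_sym[OF assms], of x]
  by (simp add: quad_def inv_simps[OF assms] unit_left[OF assms] square_inverse_square[OF assms]
      scaleR_2 algebra_simps)

text \<open>
  The previous formula is evaluated on \<open>comm u i x\<close>: this derivation commutes with multiplication by
  \<open>i \<otimes> i\<close> and its range is annihilated by \<open>U\<^sub>u\<close>, so the left-hand side vanishes.
\<close>

lemma comm_inverse_half:
  assumes "mutual_inverses e u i"
  shows "2 *\<^sub>R (i \<otimes> (u \<otimes> comm u i x)) = comm u i x"
proof -
  have "comm u i (i \<otimes> i) = 0"
    using comm_inverse_fixed[OF assms] by (simp add: comm_derivation jprod_linear)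
  then have "(i \<otimes> i) \<otimes> comm u i x = comm u i ((i \<otimes> i) \<otimes> x)"
    by (simp add: comm_derivation jprod_linear)
  then show ?thesis
    using quad_inverse_square[OF assms, of "comm u i x"] quad_comm_inverse[OF assms] by simp
qed

text \<open>
  On the range of \<open>comm u i\<close> both \<open>i u\<close> and \<open>u i\<close> act as one half. Inserting this in the sandwich
  identity shows that \<open>u\<close> annihilates the range, so that the factor one half forces the range to be
  zero.
\<close>

lemma inverse_commute:
  assumes "mutual_inverses e u i"
  shows "u \<otimes> (i \<otimes> x) = i \<otimes> (u \<otimes> x)"
proof -
  let ?d = "comm u i x"
  have half: "2 *\<^sub>R (i \<otimes> (u \<otimes> ?d)) = ?d"
    by (rule comm_inverse_half[OF assms])
  have half': "2 *\<^sub>R (u \<otimes> (i \<otimes> ?d)) = ?d"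
    using comm_inverse_half[OF mutual_inverses_sym[OF assms], of x]
    by (simp add: comm_swap[of i u] jprod_linear)
  have "u \<otimes> ?d + (u \<otimes> u) \<otimes> (i \<otimes> ?d) = u \<otimes> (2 *\<^sub>R (i \<otimes> (u \<otimes> ?d)))"
    using inverse_sandwich[OF assms, of ?d] by (simp add: jprod_linear)
  then have "(u \<otimes> u) \<otimes> (i \<otimes> ?d) = 0"
    by (simp add: half)
  moreover have "quad u (i \<otimes> ?d) = 0"
    using quad_comm_inverse[OF assms, of "i \<otimes> x"]
    by (simp add: comm_quad_of_fixed(1)[OF comm_inverse_fixed(2)[OF assms]])
  ultimately have "u \<otimes> (2 *\<^sub>R (u \<otimes> (i \<otimes> ?d))) = 0"
    by (simp add: quad_def jprod_linear)
  then have "u \<otimes> ?d = 0"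
    by (simp add: half')
  then have "?d = 0"
    using half by (simp add: jprod_linear)
  then show ?thesis by (simp add: comm_def)
qed

lemma quad_inverse:
  assumes "mutual_inverses e u i"
  shows "quad u (i \<otimes> x) = u \<otimes> x" and "quad u (quad i x) = x"
proof -
  show *: "quad u (i \<otimes> x) = u \<otimes> x" for x
    using inverse_sandwich[OF assms, of x] by (simp add: quad_def inverse_commute[OF assms])
  show "quad u (quad i x) = x"
    by (simp add: quad_def[of i] quad_linear * quad_inverse_square[OF assms]
        inverse_commute[OF assms])
qed

lemma mutual_inverses_square:
  assumes "mutual_inverses e u i"
  shows "mutual_inverses e (u \<otimes> u) (i \<otimes> i)"
proof -
  have "comm (u \<otimes> u) (i \<otimes> i) x = 0" for x
    using comm_square_polarized[of "u \<otimes> u" i x]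
    by (simp add: inv_simps[OF assms] comm_def inverse_commute[OF assms])
  then have c: "(u \<otimes> u) \<otimes> ((i \<otimes> i) \<otimes> x) = (i \<otimes> i) \<otimes> ((u \<otimes> u) \<otimes> x)" for x
    by (simp add: comm_def)
  have ui: "(u \<otimes> u) \<otimes> (i \<otimes> i) = e" "(i \<otimes> i) \<otimes> (u \<otimes> u) = e"
    using square_inverse_square[OF assms] by (simp_all add: jprod_commute)
  have "((u \<otimes> u) \<otimes> (u \<otimes> u)) \<otimes> (i \<otimes> i) = u \<otimes> u"
    using c[of "u \<otimes> u"] ui unit_right[OF assms] by (metis jprod_commute)
  moreover have "((i \<otimes> i) \<otimes> (i \<otimes> i)) \<otimes> (u \<otimes> u) = i \<otimes> i"
    using c[of "i \<otimes> i"] ui unit_right[OF assms] by (metis jprod_commute)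
  ultimately show ?thesis
    using assms ui by (simp add: mutual_inverses_def)
qed

end

section \<open>Unitaries and rigidity\<close>

context jb_star_algebra
begin

text \<open>
  For a unitary the norm axiom reads \<open>norm u = norm u ^ 3\<close>, because \<open>U\<^sub>u\<close> maps the inverse of \<open>u\<close>
  to \<open>u\<close>.
\<close>

lemma norm_unitary_le:
  assumes "mutual_inverses e u (star u)"
  shows "norm u \<le> 1"
proof -
  have "U_op jprod u (star u) = u"
    using inv_simps[OF assms] unit_left[OF assms] by (simp add: U_op_def scaleR_2)
  then have "norm u = norm u ^ 3"
    using norm_U_star[of u] by simp
  then have "norm u * (norm u ^ 2 - 1) = 0"
    by (simp add: power3_eq_cube power2_eq_square algebra_simps)
  then have "norm u = 0 \<or> norm u ^ 2 = 1"
    by simp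
  then show ?thesis
    by (auto simp: power2_eq_1_iff)
qed

lemma unitary_star: "mutual_inverses e u (star u) \<Longrightarrow> mutual_inverses e (star u) (star (star u))"
  using mutual_inverses_sym by (simp add: star_star)

lemma norm_quad_unitary_le:
  assumes "mutual_inverses e u (star u)"
  shows "norm (quad u x) \<le> 3 * norm x"
proof -
  have u: "norm (u \<otimes> y) \<le> norm y" for y
    using norm_jprod_le[of u y] mult_right_mono[OF norm_unitary_le[OF assms], of "norm y"] by simp
  have "norm (quad u x) \<le> norm (2 *\<^sub>R (u \<otimes> (u \<otimes> x))) + norm ((u \<otimes> u) \<otimes> x)"
    unfolding quad_def by (rule norm_triangle_ineq4)
  also have "norm (2 *\<^sub>R (u \<otimes> (u \<otimes> x))) \<le> 2 * norm x"
    using u[of x] u[of "u \<otimes> x"] by simp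
  also have "norm ((u \<otimes> u) \<otimes> x) \<le> norm (u \<otimes> u) * norm x"
    by (rule norm_jprod_le)
  also have "norm (u \<otimes> u) * norm x \<le> 1 * norm x"
    using u[of u] norm_unitary_le[OF assms] by (intro mult_right_mono) auto
  finally show ?thesis by simp
qed

lemma unitary_square:
  assumes "mutual_inverses e u (star u)"
  shows "mutual_inverses e (u \<otimes> u) (star (u \<otimes> u))"
  using mutual_inverses_square[OF assms] by (simp add: star_jprod)

text \<open>
  The assumption says that conjugating \<open>L\<^sub>b\<close> by \<open>U\<^sub>u\<close> adds the defect \<open>h\<close>. The bound depends on
  \<open>b\<close> but not on the unitary, so \<open>u\<close> may later be replaced by its iterated squares; the constant is
  \<open>3 * 3 + 1\<close>.
\<close>

lemma quad_defect_bound: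
  assumes u: "mutual_inverses e u (star u)"
    and conj: "\<And>x. quad u (b \<otimes> x) = b \<otimes> quad u x + h (quad u x)"
  shows "norm (h x) \<le> 10 * norm b * norm x"
proof -
  let ?y = "quad (star u) x"
  have y: "quad u ?y = x" by (rule quad_inverse(2)[OF u])
  have "h x = quad u (b \<otimes> ?y) - b \<otimes> x"
    using conj[of ?y] y by simp
  then have "norm (h x) \<le> norm (quad u (b \<otimes> ?y)) + norm (b \<otimes> x)"
    by (simp add: norm_triangle_ineq4)
  also have "norm (quad u (b \<otimes> ?y)) \<le> 3 * (norm b * (3 * norm x))"
    using norm_quad_unitary_le[OF u, of "b \<otimes> ?y"] norm_jprod_le[of b ?y]
      mult_left_mono[OF norm_quad_unitary_le[OF unitary_star[OF u], of x], of "norm b"]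
    by simp
  also have "norm (b \<otimes> x) \<le> norm b * norm x"
    by (rule norm_jprod_le)
  finally show ?thesis by simp
qed

text \<open>
  Passing from \<open>u\<close> to \<open>u \<otimes> u\<close> squares \<open>U\<^sub>u\<close> and, as \<open>h\<close> commutes with it, doubles the defect.
\<close>

lemma quad_defect_power_bound:
  assumes "mutual_inverses e u (star u)"
    and "\<And>x. quad u (b \<otimes> x) = b \<otimes> quad u x + h (quad u x)"
    and "\<And>x. h (quad u x) = quad u (h x)"
  shows "2 ^ k * norm (h x) \<le> 10 * norm b * norm x"
  using assms
proof (induction k arbitrary: u h)
  case 0
  then show ?case using quad_defect_bound[of e u b h x] by simp
next
  case (Suc k)
  have "2 ^ k * norm (2 *\<^sub>R h x) \<le> 10 * norm b * norm x"
  proof (rule Suc.IH[of "u \<otimes> u" "\<lambda>x. 2 *\<^sub>R h x"])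
    show "mutual_inverses e (u \<otimes> u) (star (u \<otimes> u))"
      by (rule unitary_square[OF Suc.prems(1)])
    fix x
    show "quad (u \<otimes> u) (b \<otimes> x) = b \<otimes> quad (u \<otimes> u) x + 2 *\<^sub>R h (quad (u \<otimes> u) x)"
      by (simp add: quad_square Suc.prems(2) quad_linear Suc.prems(3)[symmetric] scaleR_2)
    show "2 *\<^sub>R h (quad (u \<otimes> u) x) = quad (u \<otimes> u) (2 *\<^sub>R h x)"
      by (simp add: quad_square quad_linear Suc.prems(3))
  qed
  then show ?case by simp
qed

text \<open>
  A discrete counterpart of the fact that a commutator of bounded operators vanishes if it commutes
  with one of the two and that one is hermitian: the defect \<open>h\<close> satisfies bounds that
  force \<open>2 ^ k * norm (g x)\<close> to stay bounded in \<open>k\<close>.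
\<close>

lemma quad_commutator_rigid:
  assumes u: "mutual_inverses e u (star u)"
    and g: "\<And>x. quad u (b \<otimes> x) - b \<otimes> quad u x = g x"
    and gu: "\<And>x. g (quad u x) = quad u (g x)"
  shows "g x = 0"
proof -
  have inv: "quad u (quad (star u) y) = y" "quad (star u) (quad u y) = y" for y
    using quad_inverse(2)[OF u] quad_inverse(2)[OF mutual_inverses_sym[OF u]] by auto
  define h where "h y = g (quad (star u) y)" for y
  have hu: "h (quad u y) = g y" for y
    by (simp add: h_def inv)
  have "2 ^ k * norm (h y) \<le> 10 * norm b * norm y" for k y
  proof (rule quad_defect_power_bound[OF u])
    show "quad u (b \<otimes> y) = b \<otimes> quad u y + h (quad u y)" for y
      by (simp add: hu g[symmetric])
    show "h (quad u y) = quad u (h y)" for y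
      unfolding hu by (simp add: h_def gu[symmetric] inv)
  qed
  then have b: "2 ^ k * norm (g x) \<le> 10 * norm b * norm (quad u x)" for k
    using hu[of x] by metis
  show ?thesis
  proof (rule ccontr)
    assume "g x \<noteq> 0"
    then have "0 < norm (g x)" by simp
    moreover obtain k where "10 * norm b * norm (quad u x) / norm (g x) < 2 ^ k"
      using real_arch_pow[of 2] by auto
    ultimately show False
      using b[of k] by (simp add: field_simps)
  qed
qed

section \<open>Elements operator commuting with a unitary\<close>

text \<open>
  Given the hypothesis, the commutator of \<open>U\<^sub>u\<close> and \<open>L\<^sub>v\<close> is the derivation \<open>comm v (u \<otimes> u)\<close>. It
  kills \<open>u\<close>, so the rigidity principle applies.
\<close>

lemma square_commutes_with_commutant:
  assumes u: "mutual_inverses e u (star u)"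
    and uv: "\<And>x. u \<otimes> (v \<otimes> x) = v \<otimes> (u \<otimes> x)"
  shows "(u \<otimes> u) \<otimes> (v \<otimes> x) = v \<otimes> ((u \<otimes> u) \<otimes> x)"
proof -
  let ?d = "comm v (u \<otimes> u)"
  have "v \<otimes> ((u \<otimes> u) \<otimes> u) = (u \<otimes> u) \<otimes> (v \<otimes> u)"
    using uv square_commutes[of u v] by (metis jprod_commute)
  then have "?d u = 0"
    by (simp add: comm_def)
  then have "?d x = 0"
    using quad_commutator_rigid[OF u, of v ?d x] comm_quad_of_fixed(2)[of v "u \<otimes> u" u]
    by (simp add: quad_def comm_def jprod_linear uv)
  then show ?thesis by (simp add: comm_def)
qed

text \<open>
  A Fuglede type statement: multiplication by \<open>star u\<close> is the inverse of \<open>U\<^sub>u\<close> composed with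
  multiplication by \<open>u\<close>, and both factors commute with \<open>v\<close>.
\<close>

lemma star_commutes_with_commutant:
  assumes u: "mutual_inverses e u (star u)"
    and uv: "\<And>x. u \<otimes> (v \<otimes> x) = v \<otimes> (u \<otimes> x)"
  shows "star u \<otimes> (v \<otimes> x) = v \<otimes> (star u \<otimes> x)"
proof -
  have v: "quad u (v \<otimes> y) = v \<otimes> quad u y" for y
    by (simp add: quad_def jprod_linear uv square_commutes_with_commutant[OF u uv])
  have "quad u (star u \<otimes> (v \<otimes> x)) = quad u (v \<otimes> (star u \<otimes> x))"
    by (simp add: v quad_inverse(1)[OF u] uv)
  then show ?thesis
    using quad_inverse(2)[OF mutual_inverses_sym[OF u]] by metis
qed

text \<open>
  Second use of rigidity. The commutator of \<open>U\<^sub>u\<close> with multiplication by \<open>star u \<otimes> v\<close> is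
  \<open>4 L\<^sub>u E\<close> for the derivation \<open>E\<close> in question, because the contribution of \<open>u \<otimes> u\<close> is a
  multiple of \<open>comm u v\<close>. Only the composition of \<open>E\<close> with \<open>L\<^sub>u\<close> is shown to be zero,
  which is all that is needed on multiples of \<open>u\<close>.
\<close>

lemma comm_star_jprod_vanishes:
  assumes u: "mutual_inverses e u (star u)"
    and uv: "\<And>x. u \<otimes> (v \<otimes> x) = v \<otimes> (u \<otimes> x)"
  shows "comm u (star u \<otimes> v) (u \<otimes> x) = 0"
proof -
  let ?b = "star u \<otimes> v"
  let ?E = "comm u ?b"
  note u2v = square_commutes_with_commutant[OF u uv]
  have ub: "u \<otimes> ?b = v"
    using uv[of "star u"]
    by (simp add: inv_simps[OF u] unit_right[OF u] jprod_commute[of "star u"])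
  have u2b: "(u \<otimes> u) \<otimes> ?b = v \<otimes> u"
    using u2v[of "star u"] by (simp add: inv_simps[OF u] jprod_commute)
  have "?E u = u \<otimes> (u \<otimes> ?b) - (u \<otimes> u) \<otimes> ?b"
    by (simp add: comm_def jprod_commute[of ?b u] jprod_commute[of ?b "u \<otimes> u"])
  then have Eu: "?E u = 0"
    by (simp add: ub u2b jprod_commute[of v u])
  note E = comm_quad_of_fixed[OF Eu]
  have "comm ?b (u \<otimes> u) x = 0" for x
    using comm_square_polarized[of ?b u x] by (simp add: ub comm_def uv)
  then have u2: "(u \<otimes> u) \<otimes> (?b \<otimes> x) = ?b \<otimes> ((u \<otimes> u) \<otimes> x)" for x
    by (simp add: comm_def)
  have bu: "u \<otimes> (?b \<otimes> x) = ?b \<otimes> (u \<otimes> x) + ?E x" for x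
    by (simp add: comm_def)
  have "4 *\<^sub>R (u \<otimes> ?E x) = 0"
  proof (rule quad_commutator_rigid[OF u, where b = ?b and g = "\<lambda>x. 4 *\<^sub>R (u \<otimes> ?E x)"])
    show "quad u (?b \<otimes> x) - ?b \<otimes> quad u x = 4 *\<^sub>R (u \<otimes> ?E x)" for x
      by (simp add: quad_def jprod_linear u2 bu E scaleR_add_right flip: scaleR_add_left)
    show "4 *\<^sub>R (u \<otimes> ?E (quad u x)) = quad u (4 *\<^sub>R (u \<otimes> ?E x))" for x
      by (simp add: E quad_linear quad_jprod_self)
  qed
  then show ?thesis by (simp add: E)
qed

text \<open>
  Both equations result from moving factors past each other. A commutator left behind is always
  applied to a multiple of \<open>u\<close> (or \<open>v\<close>, or an adjoint) and vanishes by the preceding lemma,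
  which therefore is used with various choices of \<open>u\<close>, \<open>v\<close> and adjoints as its two elements.
\<close>

lemma unitary_jprod:
  assumes u: "mutual_inverses e u (star u)" and v: "mutual_inverses e v (star v)"
    and uv: "\<And>x. u \<otimes> (v \<otimes> x) = v \<otimes> (u \<otimes> x)"
  shows "(u \<otimes> v) \<otimes> star (u \<otimes> v) = e"
    and "((u \<otimes> v) \<otimes> (u \<otimes> v)) \<otimes> star (u \<otimes> v) = u \<otimes> v"
proof -
  let ?w = "u \<otimes> v" and ?w' = "star u \<otimes> star v"
  note unit = unit_left[OF u] unit_right[OF u]
  note iu = inv_simps[OF u] and iv = inv_simps[OF v]
  have u'v: "star u \<otimes> (v \<otimes> x) = v \<otimes> (star u \<otimes> x)" for x
    by (rule star_commutes_with_commutant[OF u uv])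
  have v'u: "star v \<otimes> (u \<otimes> x) = u \<otimes> (star v \<otimes> x)" for x
    by (rule star_commutes_with_commutant[OF v uv[symmetric]])
  have u'v': "star u \<otimes> (star v \<otimes> x) = star v \<otimes> (star u \<otimes> x)" for x
    by (rule star_commutes_with_commutant[OF u v'u[symmetric]])
  have w': "star ?w = ?w'"
    by (simp add: star_jprod jprod_commute)

  have "comm (star u) ?w (star u \<otimes> (u \<otimes> star v)) = 0"
    using comm_star_jprod_vanishes[OF unitary_star[OF u] u'v] by (simp add: star_star)
  moreover have "star u \<otimes> (u \<otimes> star v) = star v"
    using u'v'[of u] by (simp add: iu unit jprod_commute)
  moreover have "?w \<otimes> star v = u"
    using v'u[of v] by (simp add: iv unit jprod_commute)
  ultimately have ww': "?w \<otimes> ?w' = e"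
    by (simp add: comm_def iu)
  then show "?w \<otimes> star ?w = e"
    by (simp add: w')

  have "comm u ?w v = 0"
    using comm_square_polarized[of v u v] square_commutes_with_commutant[OF u uv, of v]
    by (simp add: comm_def)
  then have w2: "?w \<otimes> ?w = u \<otimes> (v \<otimes> ?w)"
    by (simp add: comm_def jprod_commute)
  have "comm u ?w' (u \<otimes> (v \<otimes> v)) = 0"
    by (rule comm_star_jprod_vanishes[OF u v'u[symmetric]])
  moreover have "u \<otimes> (v \<otimes> v) = v \<otimes> ?w"
    by (rule uv)
  ultimately have 1: "?w' \<otimes> (u \<otimes> (v \<otimes> ?w)) = u \<otimes> (?w' \<otimes> (v \<otimes> ?w))"
    by (simp add: comm_def)
  have "comm v (star v \<otimes> star u) (v \<otimes> u) = 0"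
    by (rule comm_star_jprod_vanishes[OF v u'v[symmetric]])
  then have "?w' \<otimes> (v \<otimes> ?w) = v \<otimes> (?w' \<otimes> ?w)"
    by (simp add: comm_def jprod_commute)
  also have "\<dots> = v"
    using ww' unit by (simp add: jprod_commute[of ?w'])
  finally show "(?w \<otimes> ?w) \<otimes> star ?w = ?w"
    using 1 w2 by (simp add: w' jprod_commute)
qed

lemma unitaries_iff: "u \<in> unitaries jprod star \<longleftrightarrow> (\<exists>e. mutual_inverses e u (star u))"
proof
  assume "u \<in> unitaries jprod star"
  then obtain e where e: "is_unit_element jprod e" "u \<otimes> star u = e" "(u \<otimes> u) \<otimes> star u = u"
    by (auto simp: unitaries_def jordan_inverse_def)
  have "star ((u \<otimes> u) \<otimes> star u) = star u"
    using e(3) by simp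
  then have "(star u \<otimes> star u) \<otimes> u = star u"
    by (simp add: star_jprod star_star jprod_commute)
  with e show "\<exists>e. mutual_inverses e u (star u)"
    by (auto simp: mutual_inverses_def)
qed (auto simp: unitaries_def jordan_inverse_def mutual_inverses_def)

end

section \<open>Products of operator commuting unitaries\<close>

theorem mainTheorem5:
  fixes scaleC :: "complex \<Rightarrow> 'a::banach \<Rightarrow> 'a"
    and jprod :: "'a \<Rightarrow> 'a \<Rightarrow> 'a"
    and star :: "'a \<Rightarrow> 'a"
    and scaleP :: "complex \<Rightarrow> 'p::banach \<Rightarrow> 'p"
    and u v :: 'a
  assumes "jbw_star_algebra scaleC jprod star scaleP"
    and "u \<in> unitaries jprod star"
    and "v \<in> unitaries jprod star"
    and "operator_commute jprod u v"
  shows "jprod u v \<in> unitaries jprod star"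
proof -
  interpret jbw_star_algebra scaleC jprod star scaleP by (rule assms(1))
  obtain e f where u: "mutual_inverses e u (star u)" and f: "mutual_inverses f v (star v)"
    using assms(2,3) unfolding unitaries_iff by blast
  have "f = e"
    using u f by (auto simp: mutual_inverses_def intro: is_unit_element_unique)
  then have v: "mutual_inverses e v (star v)"
    using f by simp
  have "jprod u (jprod v x) = jprod v (jprod u x)" for x
    using assms(4) unfolding operator_commute_def by (metis jprod_commute)
  note w = unitary_jprod[OF u v this]
  have "is_unit_element jprod e"
    using u by (simp add: mutual_inverses_def)
  with w show ?thesis
    by (auto simp: unitaries_def jordan_inverse_def)
qed

end
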